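(* Consider the heterogeneous networked system $\dot X(t)=FX(t)+GU(t)$ with $F=A+C\otimes H$, $G=D\otimes B$, $A=\mathrm{blockdiag}\{A_1,\ldots,A_N\}$. Suppose that there exists a node $j$ with no edges to any other nodes, i.e. the $j$-th column of the network topology matrix $C$ is zero. If $\xi H=0$ for all left eigenvectors $\xi$ of $A_j$, then the controllability of $(A_j,B)$ is necessary for the controllability of the networked system.
   Context: The networked system has $N$ nodes, each of dimension $n$: $\dot x_i(t)=A_ix_i(t)+\sum_{j=1}^Nc_{ij}Hx_j(t)+d_iBu_i(t)$, $i=1,\ldots,N$, where $x_i(t)\in\mathbb{R}^n$ is the state and $u_i(t)\in\mathbb{R}^m$ the external control input of node $i$, $A_i\in\mathbb{R}^{n\times n}$ is the state matrix of node $i$, $B\in\mathbb{R}^{n\times m}$ is the input matrix, $d_i=1$ if node $i$ is under control and $d_i=0$ otherwise, $H\in\mathbb{R}^{n\times n}$ is the inner coupling matrix, and $c_{ij}\in\mathbb{R}$ is the coupling strength, with $c_{ij}\ne0$ if there is a communication (edge) from node $j$ to node $i$ and $c_{ij}=0$ otherwise. Put $C=[c_{ij}]\in\mathbb{R}^{N\times N}$, $D=\mathrm{diag}\{d_1,\ldots,d_N\}$, $X=[x_1^T,\ldots,x_N^T]^T$, $U=[u_1^T,\ldots,u_N^T]^T$; the system then reads $\dot X=FX+GU$. "The networked system is controllable" means the pair $(F,G)$ is controllable. A pair $(M,K)$ with $M$ an $r\times r$ matrix and $K$ an $r\times s$ matrix is controllable if $[K,MK,\ldots,M^{r-1}K]$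 has rank $r$ (equivalently, $\nu K\ne0$ for every left eigenvector $\nu$ of $M$). A left eigenvector of $M$ for $\lambda\in\mathbb{C}$ is a non-zero (complex) row vector $\nu$ with $\nu M=\lambda\nu$. $\otimes$ is the Kronecker product and $\mathrm{blockdiag}$ denotes a block diagonal matrix. *)

theory Defs
  imports Complex_Main "Jordan_Normal_Form.Matrix" "Jordan_Normal_Form.DL_Rank"
begin

text \<open>
  Matrices are those of \<open>Jordan_Normal_Form.Matrix\<close>, with rows and columns counted from 0; the
  nodes of a network with \<open>N\<close> nodes are accordingly \<open>0, \<dots>, N - 1\<close>.
\<close>

definition kronecker :: "'a :: times mat \<Rightarrow> 'a mat \<Rightarrow> 'a mat" (infixl "\<otimes>\<^sub>K" 70) where
  "P \<otimes>\<^sub>K Q = mat (dim_row P * dim_row Q) (dim_col P * dim_col Q)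
     (\<lambda>(i, j). P $$ (i div dim_row Q, j div dim_col Q) * Q $$ (i mod dim_row Q, j mod dim_col Q))"

text \<open>
  The \<open>r \<times> (r * s)\<close> matrix \<open>[K, M K, \<dots>, M^(r-1) K]\<close> of an \<open>r \<times> r\<close> matrix \<open>M\<close> and an \<open>r \<times> s\<close>
  matrix \<open>K\<close>: column \<open>j\<close> is column \<open>j mod s\<close> of block \<open>j div s\<close>.
\<close>

definition controllability_mat :: "'a :: comm_ring_1 mat \<Rightarrow> 'a mat \<Rightarrow> 'a mat" where
  "controllability_mat M K = mat (dim_row M) (dim_row M * dim_col K)
     (\<lambda>(i, j). (M ^\<^sub>m (j div dim_col K) * K) $$ (i, j mod dim_col K))"

definition controllable :: "'a :: field mat \<Rightarrow> 'a mat \<Rightarrow> bool" where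
  "controllable M K \<longleftrightarrow> vec_space.rank (dim_row M) (controllability_mat M K) = dim_row M"

text \<open>A row vector \<open>v\<close> is the one-row matrix \<open>mat_of_row v\<close>.\<close>

definition left_eigenvector :: "'a :: comm_ring_1 mat \<Rightarrow> 'a vec \<Rightarrow> 'a \<Rightarrow> bool" where
  "left_eigenvector M v l \<longleftrightarrow> v \<in> carrier_vec (dim_row M) \<and> v \<noteq> 0\<^sub>v (dim_row M) \<and>
     mat_of_row v * M = l \<cdot>\<^sub>m mat_of_row v"

text \<open>
  Stacking the states \<open>x\<^sub>i\<close> and inputs \<open>u\<^sub>i\<close> of the nodes
  \<open>x\<^sub>i' = A\<^sub>i x\<^sub>i + (\<Sum>j. c\<^sub>i\<^sub>j H x\<^sub>j) + d\<^sub>i B u\<^sub>i\<close> gives \<open>X' = F X + G U\<close> with the following \<open>F\<close> and \<open>G\<close>.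
\<close>

definition network_state_mat :: "nat \<Rightarrow> (nat \<Rightarrow> real mat) \<Rightarrow> real mat \<Rightarrow> real mat \<Rightarrow> real mat" where
  "network_state_mat N A C H = diag_block_mat (map A [0..<N]) + C \<otimes>\<^sub>K H"

definition network_input_mat :: "nat \<Rightarrow> (nat \<Rightarrow> real) \<Rightarrow> real mat \<Rightarrow> real mat" where
  "network_input_mat N d B = mat_diag N d \<otimes>\<^sub>K B"

lemma network_state_mat_carrier:
  assumes "C \<in> carrier_mat N N" "H \<in> carrier_mat n n"
  shows "network_state_mat N A C H \<in> carrier_mat (N * n) (N * n)"
  using assms by (auto simp: network_state_mat_def kronecker_def)

lemma network_input_mat_carrier:
  assumes "B \<in> carrier_mat n m"
  shows "network_input_mat N d B \<in> carrier_mat (N * n) (N * m)"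
  using assms by (auto simp: network_input_mat_def kronecker_def mat_diag_def)

end

theory Submission
  imports Defs "HOL-Computational_Algebra.Fundamental_Theorem_Algebra"
begin

text \<open>
  The proof rests on the Hautus test (\<open>hautus_test\<close>): over \<open>\<complex>\<close>, a pair \<open>(M, K)\<close> is controllable
  iff no left eigenvector of \<open>M\<close> is annihilated by \<open>K\<close>. Suppose \<open>(A\<^sub>j, B)\<close> is not controllable.
  The test gives a left eigenvector \<open>\<xi>\<close> of \<open>A\<^sub>j\<close> with \<open>\<xi> B = 0\<close>, and \<open>\<xi> H = 0\<close> by hypothesis. Put
  \<open>\<xi>\<close> at node \<open>j\<close> and zero elsewhere, that is, form \<open>v = e\<^sub>j \<otimes> \<xi>\<close>. The coupling contributes
  \<open>v (C \<otimes> H) = e\<^sub>j C \<otimes> \<xi> H = 0\<close>, so \<open>v F = e\<^sub>j \<otimes> \<xi> A\<^sub>j = \<mu> v\<close>, and the inputs contribute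
  \<open>v G = e\<^sub>j D \<otimes> \<xi> B = 0\<close>. Thus \<open>v\<close> is a left eigenvector of \<open>F\<close> annihilated by \<open>G\<close>, and the
  network is not controllable.

  The rank condition becomes linear algebra through \<open>full_row_rank_iff\<close>: controllability means that
  no non-zero row vector \<open>w\<close> satisfies \<open>w M\<^sup>k K = 0\<close> for all \<open>k < n\<close>. If such a \<open>w\<close> exists, a left
  eigenvector of \<open>M\<close> is found among the combinations of \<open>w, w M, \<dots>, w M\<^sup>n\<^sup>-\<^sup>1\<close>
  (\<open>eigenvector_in_krylov_space\<close>), and \<open>K\<close> annihilates all of these. The eigenvectors are complex
  while the system is real; \<open>controllable_of_real_iff\<close> passes between the two fields. Row vectors
  are treated as column vectors multiplied by transposed matrices.
\<close>

section \<open>Row rank and annihilating vectors\<close>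

text \<open>
  Zero rows turn the matrix into a singular square one without changing its kernel.
\<close>

lemma exists_kernel_vec_if_wide:
  fixes A :: "'a :: field mat"
  assumes A: "A \<in> carrier_mat m n" and "m < n"
  obtains v where "v \<in> carrier_vec n" "v \<noteq> 0\<^sub>v n" "A *\<^sub>v v = 0\<^sub>v m"
proof -
  define A' where "A' = mat n n (\<lambda>(i, k). if i < m then A $$ (i, k) else 0)"
  have A': "A' \<in> carrier_mat n n"
    by (simp add: A'_def)
  \<comment> \<open>Row \<open>m\<close> is the first of the added zero rows.\<close>
  have "transpose_mat A' *\<^sub>v unit_vec n m = 0\<^sub>v n"
    using \<open>m < n\<close> by (intro eq_vecI) (auto simp: A'_def)
  moreover have "unit_vec n m \<noteq> (0\<^sub>v n :: 'a vec)"
    using \<open>m < n\<close> by simp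
  ultimately have "det (transpose_mat A') = 0"
    using A' det_0_iff_vec_prod_zero_field[of "transpose_mat A'" n] unit_vec_carrier[of n m]
    by (metis transpose_carrier_mat)
  then have "det A' = 0"
    using det_transpose[OF A'] by simp
  then obtain v where v: "v \<in> carrier_vec n" "v \<noteq> 0\<^sub>v n" "A' *\<^sub>v v = 0\<^sub>v n"
    using A' by (auto simp: det_0_iff_vec_prod_zero_field[of _ n])
  have "(A *\<^sub>v v) $ i = 0" if "i < m" for i
  proof -
    have "row A i = row A' i"
      using that A \<open>m < n\<close> by (intro eq_vecI) (auto simp: A'_def)
    moreover have "(A' *\<^sub>v v) $ i = 0"
      using v that \<open>m < n\<close> by simp
    ultimately show ?thesis
      using that A A' \<open>m < n\<close> by simp
  qed
  then have "A *\<^sub>v v = 0\<^sub>v m"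
    using A by (intro eq_vecI) auto
  with v that show thesis by blast
qed

text \<open>
  Being orthogonal to all columns is the same as being orthogonal to a maximal independent set \<open>S\<close>
  of them. If \<open>S\<close> has \<open>n\<close> elements it is a basis, and only zero is orthogonal to it. If it has fewer,
  orthogonality is a homogeneous system with fewer equations than unknowns.
\<close>

lemma (in vec_space) full_row_rank_iff:
  assumes K: "K \<in> carrier_mat n c"
  shows "rank K = n \<longleftrightarrow>
    (\<forall>v \<in> carrier_vec n. transpose_mat K *\<^sub>v v = 0\<^sub>v c \<longrightarrow> v = 0\<^sub>v n)"
proof -
  have cols: "set (cols K) \<subseteq> carrier_vec n"
    using cols_dim K by blast
  obtain S where S: "maximal S (\<lambda>T. T \<subseteq> set (cols K) \<and> lin_indpt T)"
    using maximal_exists_superset[of "set (cols K)" "\<lambda>T. T \<subseteq> set (cols K) \<and> lin_indpt T" "{}"]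
    by (auto simp: finite_lin_indpt2)
  have S_cols: "S \<subseteq> set (cols K)" and S_indpt: "lin_indpt S"
    using S by (auto simp: maximal_def)
  have S_fin: "finite S" and S_carrier: "S \<subseteq> carrier_vec n"
    using S_cols cols finite_subset by auto
  have rank: "rank K = card S"
    using rank_card_indpt[OF K S] .
  have card_le: "card S \<le> n"
    using li_le_dim(2)[OF fin_dim _ S_indpt] S_carrier dim_is_n by simp
  have span: "set (cols K) \<subseteq> span S"
  proof (rule ccontr)
    assume "\<not> set (cols K) \<subseteq> span S"
    then obtain s where s: "s \<in> set (cols K)" "s \<notin> span S"
      by blast
    have "lin_indpt (S \<union> {s})"
      using lin_dep_iff_in_span[OF _ S_indpt, of s] s S_carrier cols in_own_span[of S] by auto
    then have "S \<union> {s} = S"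
      using S s S_cols unfolding maximal_def by auto
    then show False
      using s in_own_span[of S] S_carrier by auto
  qed
  have orth: "transpose_mat K *\<^sub>v v = 0\<^sub>v c \<longleftrightarrow> (\<forall>s \<in> S. v \<bullet> s = 0)"
    if v: "v \<in> carrier_vec n" for v
  proof -
    have "transpose_mat K *\<^sub>v v = 0\<^sub>v c \<longleftrightarrow> (\<forall>k<c. col K k \<bullet> v = 0)"
      using K by (auto simp: vec_eq_iff)
    also have "\<dots> \<longleftrightarrow> (\<forall>s \<in> set (cols K). s \<bullet> v = 0)"
      using K by (auto simp: set_conv_nth)
    also have "\<dots> \<longleftrightarrow> (\<forall>s \<in> set (cols K). v \<bullet> s = 0)"
      using cols v comm_scalar_prod[of v n] by (metis subsetD)
    also have "\<dots> \<longleftrightarrow> (\<forall>s \<in> S. v \<bullet> s = 0)"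
    proof
      assume "\<forall>s \<in> S. v \<bullet> s = 0"
      then have "v \<in> orthogonal_complement (span S)"
        using v in_orthogonal_complement_span[OF S_carrier] by (simp add: orthogonal_complement_def)
      then show "\<forall>s \<in> set (cols K). v \<bullet> s = 0"
        using span by (auto simp: orthogonal_complement_def)
    qed (use S_cols in auto)
    finally show ?thesis .
  qed
  show ?thesis
  proof (intro iffI ballI impI)
    fix v assume full: "rank K = n" and v: "v \<in> carrier_vec n" and "transpose_mat K *\<^sub>v v = 0\<^sub>v c"
    then have "\<forall>s \<in> S. v \<bullet> s = 0"
      using orth by blast
    then have "v \<in> orthogonal_complement (span S)"
      using v in_orthogonal_complement_span[OF S_carrier] by (simp add: orthogonal_complement_def)
    moreover have "basis S"
      using dim_li_is_basis[OF fin_dim S_fin _ S_indpt] S_carrier full rank dim_is_n by auto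
    then have "span S = carrier_vec n"
      by (simp add: basis_def)
    ultimately have "v \<bullet> unit_vec n i = 0" if "i < n" for i
      by (auto simp: orthogonal_complement_def)
    then show "v = 0\<^sub>v n"
      using v by (intro eq_vecI) auto
  next
    assume inj: "\<forall>v \<in> carrier_vec n. transpose_mat K *\<^sub>v v = 0\<^sub>v c \<longrightarrow> v = 0\<^sub>v n"
    show "rank K = n"
    proof (rule ccontr)
      assume "rank K \<noteq> n"
      then have less: "card S < n"
        using card_le rank by simp
      obtain ss where ss: "set ss = S" "length ss = card S"
        using S_fin distinct_card finite_distinct_list by metis
      obtain v where v: "v \<in> carrier_vec n" "v \<noteq> 0\<^sub>v n" "mat_of_rows n ss *\<^sub>v v = 0\<^sub>v (card S)"
        using exists_kernel_vec_if_wide[OF _ less, of "mat_of_rows n ss"] mat_of_rows_carrier(1)[of n ss]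
        unfolding ss(2) by metis
      have "v \<bullet> s = 0" if "s \<in> S" for s
      proof -
        obtain i where i: "i < length ss" "s = ss ! i"
          using \<open>s \<in> S\<close> ss by (metis in_set_conv_nth)
        have "(mat_of_rows n ss *\<^sub>v v) $ i = 0"
          using v i ss by simp
        then have "s \<bullet> v = 0"
          using i S_carrier \<open>s \<in> S\<close> by auto
        then show ?thesis
          using comm_scalar_prod[of v n s] v S_carrier \<open>s \<in> S\<close> by auto
      qed
      then show False
        using orth inj v by blast
    qed
  qed
qed

section \<open>Controllability over the reals and the complex numbers\<close>

lemma block_index_less:
  fixes j N s n :: nat
  assumes "j < N" "s < n"
  shows "j * n + s < N * n"
proof -
  have "j * n + s < Suc j * n"
    using assms by simp
  also have "\<dots> \<le> N * n"
    using assms by (intro mult_right_mono) auto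
  finally show ?thesis .
qed

lemma controllable_iff_no_annihilator:
  fixes M K :: "'a :: field mat"
  assumes M: "M \<in> carrier_mat n n" and K: "K \<in> carrier_mat n m"
  shows "controllable M K \<longleftrightarrow>
    (\<forall>v \<in> carrier_vec n. (\<forall>k<n. transpose_mat (M ^\<^sub>m k * K) *\<^sub>v v = 0\<^sub>v m) \<longrightarrow> v = 0\<^sub>v n)"
proof -
  interpret vec_space "TYPE('a)" n .
  let ?R = "controllability_mat M K"
  have R: "?R \<in> carrier_mat n (n * m)"
    using M K by (simp add: controllability_mat_def)
  have MkK: "M ^\<^sub>m k * K \<in> carrier_mat n m" for k
    using pow_carrier_mat[OF M] K by (rule mult_carrier_mat)
  have col: "col ?R (k * m + l) = col (M ^\<^sub>m k * K) l" if "k < n" "l < m" for k l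
    using that block_index_less[OF that] M K MkK[of k]
    by (intro eq_vecI) (auto simp: controllability_mat_def)
  have ann: "transpose_mat (M ^\<^sub>m k * K) *\<^sub>v v = 0\<^sub>v m \<longleftrightarrow> (\<forall>l<m. col (M ^\<^sub>m k * K) l \<bullet> v = 0)"
    for k v
    using MkK[of k] by (auto simp: vec_eq_iff simp del: col_mult2)
  have "transpose_mat ?R *\<^sub>v v = 0\<^sub>v (n * m) \<longleftrightarrow>
      (\<forall>k<n. transpose_mat (M ^\<^sub>m k * K) *\<^sub>v v = 0\<^sub>v m)" for v
  proof -
    have "transpose_mat ?R *\<^sub>v v = 0\<^sub>v (n * m) \<longleftrightarrow> (\<forall>c<n * m. col ?R c \<bullet> v = 0)"
      using R by (auto simp: vec_eq_iff)
    also have "\<dots> \<longleftrightarrow> (\<forall>k<n. \<forall>l<m. col ?R (k * m + l) \<bullet> v = 0)"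
    proof (intro iffI allI impI)
      fix c assume *: "\<forall>k<n. \<forall>l<m. col ?R (k * m + l) \<bullet> v = 0" and c: "c < n * m"
      have "c div m < n" "c mod m < m"
        using c by (auto simp: less_mult_imp_div_less intro!: mod_less_divisor gr0I)
      then have "col ?R (c div m * m + c mod m) \<bullet> v = 0"
        using * by blast
      then show "col ?R c \<bullet> v = 0"
        by simp
    qed (use block_index_less in auto)
    also have "\<dots> \<longleftrightarrow> (\<forall>k<n. transpose_mat (M ^\<^sub>m k * K) *\<^sub>v v = 0\<^sub>v m)"
      by (simp add: ann col del: col_mult2)
    finally show ?thesis .
  qed
  then show ?thesis
    using full_row_rank_iff[OF R] M by (simp add: controllable_def)
qed

text \<open>
  A real annihilating vector is also a complex one. Conversely, since the matrices are real, the real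
  and imaginary parts of a complex annihilating vector are themselves annihilating, and one of them
  is non-zero.
\<close>

lemma controllable_of_real_iff:
  fixes M K :: "real mat"
  assumes M: "M \<in> carrier_mat n n" and K: "K \<in> carrier_mat n m"
  shows "controllable (map_mat complex_of_real M) (map_mat complex_of_real K) \<longleftrightarrow> controllable M K"
proof -
  let ?M = "map_mat complex_of_real M" and ?K = "map_mat complex_of_real K"
  have cM: "?M \<in> carrier_mat n n" and cK: "?K \<in> carrier_mat n m"
    using M K by auto
  have MkK: "M ^\<^sub>m k * K \<in> carrier_mat n m" for k
    using pow_carrier_mat[OF M] K by (rule mult_carrier_mat)
  have prod: "?M ^\<^sub>m k * ?K = map_mat complex_of_real (M ^\<^sub>m k * K)" for k
    using of_real_hom.mat_hom_mult[OF pow_carrier_mat[OF M, of k] K] of_real_hom.mat_hom_pow[OF M, of k]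
    by metis
  have transp: "transpose_mat (map_mat complex_of_real X) = map_mat complex_of_real (transpose_mat X)"
    for X by (intro eq_matI) auto
  have Re: "map_vec Re (map_mat complex_of_real X *\<^sub>v v) = X *\<^sub>v map_vec Re v"
   and Im: "map_vec Im (map_mat complex_of_real X *\<^sub>v v) = X *\<^sub>v map_vec Im v"
    if "X \<in> carrier_mat m n" "v \<in> carrier_vec n" for X v
    using that by (auto intro!: eq_vecI simp: scalar_prod_def)
  have Re0: "map_vec Re (0\<^sub>v k) = 0\<^sub>v k" and Im0: "map_vec Im (0\<^sub>v k) = 0\<^sub>v k" for k
    by (auto intro!: eq_vecI)
  show ?thesis
    unfolding controllable_iff_no_annihilator[OF M K] controllable_iff_no_annihilator[OF cM cK]
      prod transp
  proof (intro iffI ballI impI)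
    fix v :: "real vec"
    assume *: "\<forall>v \<in> carrier_vec n.
        (\<forall>k<n. map_mat complex_of_real (transpose_mat (M ^\<^sub>m k * K)) *\<^sub>v v = 0\<^sub>v m) \<longrightarrow> v = 0\<^sub>v n"
      and v: "v \<in> carrier_vec n"
      and ann: "\<forall>k<n. transpose_mat (M ^\<^sub>m k * K) *\<^sub>v v = 0\<^sub>v m"
    have "map_mat complex_of_real (transpose_mat (M ^\<^sub>m k * K)) *\<^sub>v map_vec complex_of_real v = 0\<^sub>v m"
      if "k < n" for k
      using ann that of_real_hom.mult_mat_vec_hom[of "transpose_mat (M ^\<^sub>m k * K)" m n v] MkK v
      by (metis of_real_hom.vec_hom_zero transpose_carrier_mat)
    moreover have "map_vec complex_of_real v \<in> carrier_vec n"
      using v by simp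
    ultimately have "map_vec complex_of_real v = 0\<^sub>v n"
      using * by blast
    then show "v = 0\<^sub>v n"
      by (simp add: of_real_hom.vec_hom_zero_iff)
  next
    fix v :: "complex vec"
    assume *: "\<forall>v \<in> carrier_vec n.
        (\<forall>k<n. transpose_mat (M ^\<^sub>m k * K) *\<^sub>v v = 0\<^sub>v m) \<longrightarrow> v = 0\<^sub>v n"
      and v: "v \<in> carrier_vec n"
      and ann: "\<forall>k<n. map_mat complex_of_real (transpose_mat (M ^\<^sub>m k * K)) *\<^sub>v v = 0\<^sub>v m"
    have "transpose_mat (M ^\<^sub>m k * K) *\<^sub>v map_vec Re v = 0\<^sub>v m"
      "transpose_mat (M ^\<^sub>m k * K) *\<^sub>v map_vec Im v = 0\<^sub>v m" if "k < n" for k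
      using ann that Re[of "transpose_mat (M ^\<^sub>m k * K)" v] Im[of "transpose_mat (M ^\<^sub>m k * K)" v]
        MkK[of k] v Re0[of m] Im0[of m] by simp_all
    then have "map_vec Re v = 0\<^sub>v n" "map_vec Im v = 0\<^sub>v n"
      using * v by simp_all
    then show "v = 0\<^sub>v n"
      using v by (auto simp: vec_eq_iff complex_eq_iff)
  qed
qed

section \<open>The Hautus test\<close>

lemma left_eigenvector_iff:
  assumes "M \<in> carrier_mat n n"
  shows "left_eigenvector M v l \<longleftrightarrow>
    v \<in> carrier_vec n \<and> v \<noteq> 0\<^sub>v n \<and> transpose_mat M *\<^sub>v v = l \<cdot>\<^sub>v v"
proof -
  have "mat_of_row v * M = l \<cdot>\<^sub>m mat_of_row v \<longleftrightarrow> transpose_mat M *\<^sub>v v = l \<cdot>\<^sub>v v"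
    if v: "v \<in> carrier_vec n"
  proof -
    have "mat_of_row v * M = l \<cdot>\<^sub>m mat_of_row v \<longleftrightarrow> (\<forall>k<n. v \<bullet> col M k = l * v $ k)"
      using v assms by (auto simp: mat_eq_iff)
    also have "\<dots> \<longleftrightarrow> (\<forall>k<n. col M k \<bullet> v = l * v $ k)"
      using v assms by (metis comm_scalar_prod col_carrier_vec carrier_matD)
    also have "\<dots> \<longleftrightarrow> transpose_mat M *\<^sub>v v = l \<cdot>\<^sub>v v"
      using v assms by (auto simp: vec_eq_iff)
    finally show ?thesis .
  qed
  then show ?thesis
    using assms by (auto simp: left_eigenvector_def)
qed

lemma mat_of_row_mult_eq_0_iff:
  fixes M :: "'a :: comm_ring_1 mat"
  assumes "M \<in> carrier_mat n m" and v: "v \<in> carrier_vec n"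
  shows "mat_of_row v * M = 0\<^sub>m 1 m \<longleftrightarrow> transpose_mat M *\<^sub>v v = 0\<^sub>v m"
proof -
  have "mat_of_row v * M = 0\<^sub>m 1 m \<longleftrightarrow> (\<forall>k<m. v \<bullet> col M k = 0)"
    using v assms by (auto simp: mat_eq_iff)
  also have "\<dots> \<longleftrightarrow> (\<forall>k<m. col M k \<bullet> v = 0)"
    using v assms by (metis comm_scalar_prod col_carrier_vec carrier_matD)
  also have "\<dots> \<longleftrightarrow> transpose_mat M *\<^sub>v v = 0\<^sub>v m"
    using v assms by (auto simp: vec_eq_iff)
  finally show ?thesis .
qed

lemma transpose_mult_vec:
  fixes X Y :: "'a :: comm_ring_1 mat"
  assumes "X \<in> carrier_mat n k" "Y \<in> carrier_mat k m" "v \<in> carrier_vec n"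
  shows "transpose_mat (X * Y) *\<^sub>v v = transpose_mat Y *\<^sub>v (transpose_mat X *\<^sub>v v)"
  using assms by (simp add: transpose_mult[of X n k Y m])

text \<open>
  The \<open>n + 1\<close> vectors \<open>w, w M, \<dots>, w M\<^sup>n\<close> are dependent, so \<open>w p(M) = 0\<close> for some non-zero polynomial
  \<open>p\<close> of degree at most \<open>n\<close>. Choose \<open>p\<close> of least degree. It is not constant, so it has a root \<open>z\<close>;
  write \<open>p = (X - z) r\<close>. Then \<open>w r(M)\<close> is non-zero by minimality, and \<open>w r(M) (M - z) = 0\<close>. Because
  \<open>r\<close> has degree below \<open>n\<close>, this eigenvector only involves powers \<open>M\<^sup>i\<close> with \<open>i < n\<close>, which are exactly
  those that occur in the controllability matrix.
\<close>

lemma eigenvector_in_krylov_space: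
  fixes M :: "complex mat"
  assumes M: "M \<in> carrier_mat n n" and w: "w \<in> carrier_vec n" "w \<noteq> 0\<^sub>v n"
  obtains c z where
    "left_eigenvector M (vec n (\<lambda>k. \<Sum>i<n. c i * (transpose_mat (M ^\<^sub>m i) *\<^sub>v w) $ k)) z"
proof -
  define x where "x i = transpose_mat (M ^\<^sub>m i) *\<^sub>v w" for i
  \<comment> \<open>For \<open>degree p \<le> n\<close>, \<open>comb p\<close> is \<open>w p(M)\<close>.\<close>
  define comb where "comb p = vec n (\<lambda>k. \<Sum>i<Suc n. coeff p i * x i $ k)" for p
  have x_carrier: "x i \<in> carrier_vec n" for i
    unfolding x_def using pow_carrier_mat[OF M] w(1) by (intro mult_mat_vec_carrier[of _ n n] transpose_carrier_mat[THEN iffD2])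
  have x_0: "x 0 = w"
    using M w by (simp add: x_def)
  have x_Suc: "x (Suc i) = transpose_mat M *\<^sub>v x i" for i
    using transpose_mult_vec[OF pow_carrier_mat[OF M, of i] M w(1)] M by (simp add: x_def)
  obtain k\<^sub>0 where k\<^sub>0: "k\<^sub>0 < n" "w $ k\<^sub>0 \<noteq> 0"
    using w by (auto simp: vec_eq_iff)

  define dependency where "dependency p \<longleftrightarrow> p \<noteq> 0 \<and> degree p \<le> n \<and> comb p = 0\<^sub>v n" for p
  have "\<exists>p. dependency p"
  proof -
    define X where "X = mat n (Suc n) (\<lambda>(k, i). x i $ k)"
    have "X \<in> carrier_mat n (Suc n)"
      by (simp add: X_def)
    then obtain v where v: "v \<in> carrier_vec (Suc n)" "v \<noteq> 0\<^sub>v (Suc n)" "X *\<^sub>v v = 0\<^sub>v n"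
      using exists_kernel_vec_if_wide[of X n "Suc n"] by auto
    define p where "p = Poly (list_of_vec v)"
    have coeff_p: "coeff p i = (if i < Suc n then v $ i else 0)" for i
      using v by (auto simp: p_def nth_default_def list_of_vec_index)
    have "p \<noteq> 0"
      using v coeff_p by (auto simp: vec_eq_iff poly_eq_iff)
    moreover have "degree p \<le> n"
      by (rule degree_le) (simp add: coeff_p)
    moreover have "comb p $ k = (X *\<^sub>v v) $ k" if "k < n" for k
      using that v(1) by (auto simp: comb_def X_def scalar_prod_def coeff_p atLeast0LessThan
        mult.commute intro!: sum.cong simp del: sum.lessThan_Suc)
    then have "comb p = 0\<^sub>v n"
      using v by (intro eq_vecI) (auto simp: comb_def)
    ultimately show ?thesis
      unfolding dependency_def by blast
  qed
  then obtain p where p: "dependency p" and least: "\<And>q. dependency q \<Longrightarrow> degree p \<le> degree q"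
    using ex_has_least_nat[of dependency _ degree] by blast
  have "degree p \<noteq> 0"
  proof
    assume "degree p = 0"
    then obtain a where a: "p = [:a:]"
      using degree_eq_zeroE by blast
    have "comb p $ k\<^sub>0 = a * w $ k\<^sub>0"
      using k\<^sub>0 x_0 by (simp add: comb_def a sum.lessThan_Suc_shift del: sum.lessThan_Suc)
    then show False
      using p k\<^sub>0 a by (simp add: dependency_def)
  qed
  then have "\<not> constant (poly p)"
    unfolding constant_degree .
  then obtain z where "poly p z = 0"
    using fundamental_theorem_of_algebra by metis
  then have "[:- z, 1:] dvd p"
    unfolding poly_eq_0_iff_dvd .
  then obtain r where r: "p = [:- z, 1:] * r" ..
  have "r \<noteq> 0"
    using r p by (auto simp: dependency_def)
  have deg_r: "degree p = Suc (degree r)"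
    using \<open>r \<noteq> 0\<close> unfolding r by (subst degree_mult_eq) auto
  then have r_n: "coeff r n = 0"
    using p by (intro coeff_eq_0) (simp add: dependency_def)
  have "comb r \<noteq> 0\<^sub>v n"
    using least[of r] deg_r \<open>r \<noteq> 0\<close> p by (auto simp: dependency_def)
  moreover have "transpose_mat M *\<^sub>v comb r = z \<cdot>\<^sub>v comb r"
  proof (intro eq_vecI)
    fix k assume "k < dim_vec (z \<cdot>\<^sub>v comb r)"
    then have k: "k < n"
      by (simp add: comb_def)
    have comb_r: "comb r $ l = (\<Sum>i<n. coeff r i * x i $ l)" if "l < n" for l
      using that by (simp add: comb_def r_n)
    have "(transpose_mat M *\<^sub>v comb r) $ k = (\<Sum>l<n. M $$ (l, k) * comb r $ l)"
      using M k by (simp add: scalar_prod_def atLeast0LessThan comb_def)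
    also have "\<dots> = (\<Sum>l<n. \<Sum>i<n. coeff r i * (M $$ (l, k) * x i $ l))"
      by (simp add: comb_r sum_distrib_left mult_ac)
    also have "\<dots> = (\<Sum>i<n. \<Sum>l<n. coeff r i * (M $$ (l, k) * x i $ l))"
      by (rule sum.swap)
    also have "\<dots> = (\<Sum>i<n. coeff r i * x (Suc i) $ k)"
      using M k
      by (simp add: x_Suc scalar_prod_def atLeast0LessThan sum_distrib_left carrier_vecD[OF x_carrier])
    \<comment> \<open>\<open>pCons 0 r\<close> is \<open>X r\<close>, which equals \<open>p + z r\<close>.\<close>
    also have "\<dots> = (\<Sum>i<Suc n. coeff (pCons 0 r) i * x i $ k)"
      by (simp add: sum.lessThan_Suc_shift del: sum.lessThan_Suc)
    also have "\<dots> = comb p $ k + z * comb r $ k"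
    proof -
      have "coeff p i * x i $ k = coeff (pCons 0 r) i * x i $ k - z * (coeff r i * x i $ k)" for i
        unfolding r by (simp add: left_diff_distrib)
      then have "comb p $ k =
          (\<Sum>i<Suc n. coeff (pCons 0 r) i * x i $ k - z * (coeff r i * x i $ k))"
        using k by (simp only: comb_def index_vec)
      also have "\<dots> = (\<Sum>i<Suc n. coeff (pCons 0 r) i * x i $ k) - z * comb r $ k"
        using k by (simp only: comb_def index_vec sum_subtractf sum_distrib_left)
      finally show ?thesis
        by (simp only: diff_add_cancel)
    qed
    finally show "(transpose_mat M *\<^sub>v comb r) $ k = (z \<cdot>\<^sub>v comb r) $ k"
      using p k by (simp add: dependency_def) (simp add: comb_def)
  qed (use M in \<open>auto simp: comb_def\<close>)
  moreover have "comb r = vec n (\<lambda>k. \<Sum>i<n. coeff r i * x i $ k)"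
    by (simp add: comb_def r_n)
  ultimately have "left_eigenvector M (vec n (\<lambda>k. \<Sum>i<n. coeff r i * x i $ k)) z"
    using M by (simp add: left_eigenvector_iff)
  then show thesis
    using that unfolding x_def by blast
qed

text \<open>
  A left eigenvector with \<open>v K = 0\<close> satisfies \<open>v M\<^sup>k K = l\<^sup>k v K = 0\<close>, so it annihilates the
  controllability matrix. Conversely, if \<open>w M\<^sup>k K = 0\<close> for all \<open>k < n\<close>, then \<open>K\<close> annihilates every
  combination of the \<open>w M\<^sup>k\<close>, in particular the eigenvector that lies among them.
\<close>

theorem hautus_test:
  fixes M K :: "complex mat"
  assumes M: "M \<in> carrier_mat n n" and K: "K \<in> carrier_mat n m"
  shows "controllable M K \<longleftrightarrow>
    (\<forall>v l. left_eigenvector M v l \<longrightarrow> mat_of_row v * K \<noteq> 0\<^sub>m 1 m)"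
proof (intro iffI allI impI notI)
  fix v l
  assume ctrl: "controllable M K" and ev: "left_eigenvector M v l"
    and vK: "mat_of_row v * K = 0\<^sub>m 1 m"
  have v: "v \<in> carrier_vec n" "v \<noteq> 0\<^sub>v n" "transpose_mat M *\<^sub>v v = l \<cdot>\<^sub>v v"
    using ev M by (auto simp: left_eigenvector_iff)
  have vK0: "transpose_mat K *\<^sub>v v = 0\<^sub>v m"
    using vK mat_of_row_mult_eq_0_iff[OF K v(1)] by simp
  have pow: "transpose_mat (M ^\<^sub>m k) *\<^sub>v v = (l ^ k) \<cdot>\<^sub>v v" for k
  proof (induction k)
    case (Suc k)
    have "transpose_mat (M ^\<^sub>m Suc k) *\<^sub>v v = transpose_mat M *\<^sub>v (l ^ k \<cdot>\<^sub>v v)"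
      using transpose_mult_vec[OF pow_carrier_mat[OF M, of k] M v(1)] Suc by simp
    also have "\<dots> = l ^ k \<cdot>\<^sub>v (l \<cdot>\<^sub>v v)"
      using M v by (simp add: mult_mat_vec[of _ n n])
    finally show ?case
      by (simp add: smult_smult_assoc mult.commute)
  qed (use M v in simp)
  have "transpose_mat (M ^\<^sub>m k * K) *\<^sub>v v = 0\<^sub>v m" for k
    using transpose_mult_vec[OF pow_carrier_mat[OF M, of k] K v(1)] pow[of k] vK0 K v
    by (auto simp: mult_mat_vec[of _ m n])
  then show False
    using ctrl v controllable_iff_no_annihilator[OF M K] by blast
next
  assume no_ev: "\<forall>v l. left_eigenvector M v l \<longrightarrow> mat_of_row v * K \<noteq> 0\<^sub>m 1 m"
  show "controllable M K"
  proof (rule ccontr)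
    assume "\<not> controllable M K"
    then obtain w where w: "w \<in> carrier_vec n" "w \<noteq> 0\<^sub>v n"
      and ann: "\<And>k. k < n \<Longrightarrow> transpose_mat (M ^\<^sub>m k * K) *\<^sub>v w = 0\<^sub>v m"
      using controllable_iff_no_annihilator[OF M K] by blast
    define x where "x i = transpose_mat (M ^\<^sub>m i) *\<^sub>v w" for i
    obtain c z where u: "left_eigenvector M (vec n (\<lambda>k. \<Sum>i<n. c i * x i $ k)) z"
      using eigenvector_in_krylov_space[OF M w] unfolding x_def by metis
    let ?u = "vec n (\<lambda>k. \<Sum>i<n. c i * x i $ k)"
    have x: "x i \<in> carrier_vec n" for i
      unfolding x_def using pow_carrier_mat[OF M] w(1) by (intro mult_mat_vec_carrier[of _ n n] transpose_carrier_mat[THEN iffD2])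
    have Kx: "transpose_mat K *\<^sub>v x i = 0\<^sub>v m" if "i < n" for i
      using transpose_mult_vec[OF pow_carrier_mat[OF M, of i] K w(1)] ann[OF that]
      by (simp add: x_def)
    have "(transpose_mat K *\<^sub>v ?u) $ l = 0" if l: "l < m" for l
    proof -
      have "(transpose_mat K *\<^sub>v ?u) $ l = (\<Sum>k<n. \<Sum>i<n. c i * (K $$ (k, l) * x i $ k))"
        using K l by (simp add: scalar_prod_def atLeast0LessThan sum_distrib_left mult_ac)
      also have "\<dots> = (\<Sum>i<n. \<Sum>k<n. c i * (K $$ (k, l) * x i $ k))"
        by (rule sum.swap)
      also have "\<dots> = (\<Sum>i<n. c i * (transpose_mat K *\<^sub>v x i) $ l)"
        using K l by (simp add: scalar_prod_def atLeast0LessThan sum_distrib_left carrier_vecD[OF x])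
      also have "\<dots> = 0"
        using Kx l by simp
      finally show ?thesis .
    qed
    then have "transpose_mat K *\<^sub>v ?u = 0\<^sub>v m"
      using K by (intro eq_vecI) auto
    then have "mat_of_row ?u * K = 0\<^sub>m 1 m"
      using mat_of_row_mult_eq_0_iff[OF K vec_carrier] by blast
    then show False
      using no_ev[rule_format, OF u] by contradiction
  qed
qed

section \<open>Vectors supported at one node of the network\<close>

lemma index_diag_block_mat_uniform:
  assumes "\<And>i. i < N \<Longrightarrow> A i \<in> carrier_mat n n" and "r < N * n" "c < N * n"
  shows "diag_block_mat (map A [0..<N]) $$ (r, c) =
    (if r div n = c div n then A (r div n) $$ (r mod n, c mod n) else 0)"
  using assms
proof (induction N arbitrary: r c)
  case (Suc N)
  let ?D = "diag_block_mat (map A [0..<N])"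
  have "n > 0"
    using Suc.prems by (cases n) auto
  have D: "dim_row ?D = N * n" "dim_col ?D = N * n"
    using carrier_matD[OF Suc.prems(1)]
    by (auto simp: dim_diag_block_mat interv_sum_list_conv_sum_set_nat o_def)
  have AN: "A N \<in> carrier_mat n n"
    using Suc.prems(1) by simp
  have entry: "diag_block_mat (map A [0..<Suc N]) $$ (r, c) =
      (if r < N * n then if c < N * n then ?D $$ (r, c) else 0
       else if c < N * n then 0 else A N $$ (r - N * n, c - N * n))"
    using D AN Suc.prems(2,3) by (auto simp: diag_block_mat_last Let_def)
  have less: "s < N * n \<longleftrightarrow> s div n < N" for s
    using \<open>n > 0\<close> by (simp add: div_less_iff_less_mult)
  have last: "s div n = N" "s mod n = s - N * n" if "\<not> s < N * n" "s < Suc N * n" for s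
  proof -
    show "s div n = N"
      using that less[of s] less_mult_imp_div_less[of s "Suc N" n] by simp
    then show "s mod n = s - N * n"
      by (metis minus_div_mult_eq_mod)
  qed
  consider "r < N * n" "c < N * n" | "r < N * n" "\<not> c < N * n"
    | "\<not> r < N * n" "c < N * n" | "\<not> r < N * n" "\<not> c < N * n"
    by blast
  then show ?case
  proof cases
    case 1
    then show ?thesis
      using entry Suc.IH[OF Suc.prems(1)] by simp
  next
    case 2
    then have "r div n \<noteq> c div n"
      using less[of r] last(1)[of c] Suc.prems(3) by auto
    then show ?thesis
      using 2 entry by simp
  next
    case 3
    then have "r div n \<noteq> c div n"
      using less[of c] last(1)[of r] Suc.prems(2) by auto
    then show ?thesis
      using 3 entry by simp
  next
    case 4
    then show ?thesis
      using entry last[of r] last[of c] Suc.prems(2,3) by simp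
  qed
qed simp

text \<open>The stacked vector \<open>e\<^sub>j \<otimes> v\<close>.\<close>

definition at_node :: "nat \<Rightarrow> nat \<Rightarrow> nat \<Rightarrow> 'a :: zero vec \<Rightarrow> 'a vec" where
  "at_node N n j v = vec (N * n) (\<lambda>i. if i div n = j then v $ (i mod n) else 0)"

lemma sum_at_node:
  fixes v :: "'a :: comm_ring_1 vec"
  assumes "j < N"
  shows "(\<Sum>i<N * n. f i * at_node N n j v $ i) = (\<Sum>s<n. f (j * n + s) * v $ s)"
proof -
  note sub = block_index_less[OF assms]
  have "(\<Sum>i<N * n. f i * at_node N n j v $ i) =
      (\<Sum>i \<in> (\<lambda>s. j * n + s) ` {..<n}. f i * at_node N n j v $ i)"
  proof (rule sum.mono_neutral_right)
    show "\<forall>i \<in> {..<N * n} - (\<lambda>s. j * n + s) ` {..<n}. f i * at_node N n j v $ i = 0"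
    proof
      fix i assume i: "i \<in> {..<N * n} - (\<lambda>s. j * n + s) ` {..<n}"
      then have "n > 0"
        by (cases n) auto
      have "i div n \<noteq> j"
      proof
        assume "i div n = j"
        then have "i = j * n + i mod n" "i mod n < n"
          using div_mult_mod_eq[of i n] \<open>n > 0\<close> by auto
        then show False
          using i by blast
      qed
      then show "f i * at_node N n j v $ i = 0"
        using i by (simp add: at_node_def)
    qed
  qed (use sub in auto)
  also have "\<dots> = (\<Sum>s<n. f (j * n + s) * at_node N n j v $ (j * n + s))"
    by (subst sum.reindex) (auto simp: inj_on_def)
  also have "\<dots> = (\<Sum>s<n. f (j * n + s) * v $ s)"
    using sub by (intro sum.cong) (auto simp: at_node_def)
  finally show ?thesis .
qed

lemma at_node_eq_0_iff:
  assumes "j < N" "v \<in> carrier_vec n"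
  shows "at_node N n j v = 0\<^sub>v (N * n) \<longleftrightarrow> v = 0\<^sub>v n"
proof
  assume 0: "at_node N n j v = 0\<^sub>v (N * n)"
  have "v $ s = 0" if "s < n" for s
  proof -
    have "at_node N n j v $ (j * n + s) = 0"
      using 0 block_index_less[OF assms(1) that] by simp
    then show ?thesis
      using block_index_less[OF assms(1) that] that by (simp add: at_node_def)
  qed
  then show "v = 0\<^sub>v n"
    using assms by (intro eq_vecI) auto
next
  assume "v = 0\<^sub>v n"
  then show "at_node N n j v = 0\<^sub>v (N * n)"
    by (intro eq_vecI) (auto simp: at_node_def intro!: index_zero_vec mod_less_divisor gr0I)
qed

text \<open>
  On \<open>e\<^sub>j \<otimes> v\<close>, the coupling term gives \<open>e\<^sub>j C \<otimes> v H\<close>, which vanishes with \<open>v H\<close>; what is left is the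
  action of the diagonal block of node \<open>j\<close>.
\<close>

lemma transpose_network_state_mat_at_node:
  fixes v :: "complex vec"
  assumes A: "\<And>i. i < N \<Longrightarrow> A i \<in> carrier_mat n n"
    and C: "C \<in> carrier_mat N N" and H: "H \<in> carrier_mat n n"
    and j: "j < N" and v: "v \<in> carrier_vec n"
    and vH: "transpose_mat (map_mat complex_of_real H) *\<^sub>v v = 0\<^sub>v n"
  shows "transpose_mat (map_mat complex_of_real (network_state_mat N A C H)) *\<^sub>v at_node N n j v =
    at_node N n j (transpose_mat (map_mat complex_of_real (A j)) *\<^sub>v v)"
proof (rule eq_vecI)
  fix c assume "c < dim_vec (at_node N n j (transpose_mat (map_mat complex_of_real (A j)) *\<^sub>v v))"
  then have c: "c < N * n"
    by (simp add: at_node_def)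
  then have "n > 0"
    by (cases n) auto
  let ?F = "network_state_mat N A C H"
  have F: "?F \<in> carrier_mat (N * n) (N * n)"
    using C H by (rule network_state_mat_carrier)
  have cm: "c mod n < n" and cd: "c div n < N"
    using \<open>n > 0\<close> c by (auto simp: less_mult_imp_div_less)
  have entry: "?F $$ (j * n + s, c) =
      (if c div n = j then A j $$ (s, c mod n) else 0) + C $$ (j, c div n) * H $$ (s, c mod n)"
    if s: "s < n" for s
  proof -
    have row: "j * n + s < N * n"
      using j s by (rule block_index_less)
    have "?F $$ (j * n + s, c) =
        diag_block_mat (map A [0..<N]) $$ (j * n + s, c) + (C \<otimes>\<^sub>K H) $$ (j * n + s, c)"
      using row c C H by (simp add: network_state_mat_def kronecker_def)
    then show ?thesis
      using row c C H s index_diag_block_mat_uniform[of N A n "j * n + s" c] A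
      by (auto simp: kronecker_def)
  qed
  have H_part: "(\<Sum>s<n. complex_of_real (H $$ (s, c mod n)) * v $ s) = 0"
  proof -
    have "(transpose_mat (map_mat complex_of_real H) *\<^sub>v v) $ (c mod n) = 0"
      using vH cm by simp
    then show ?thesis
      using H v cm by (simp add: scalar_prod_def atLeast0LessThan carrier_vecD)
  qed
  have "(transpose_mat (map_mat complex_of_real ?F) *\<^sub>v at_node N n j v) $ c =
      (\<Sum>i<N * n. complex_of_real (?F $$ (i, c)) * at_node N n j v $ i)"
    using F c by (simp add: scalar_prod_def atLeast0LessThan at_node_def)
  also have "\<dots> = (\<Sum>s<n. complex_of_real (?F $$ (j * n + s, c)) * v $ s)"
    by (rule sum_at_node[OF j])
  also have "\<dots> = (\<Sum>s<n. (if c div n = j then A j $$ (s, c mod n) else 0) * v $ s)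
      + C $$ (j, c div n) * (\<Sum>s<n. complex_of_real (H $$ (s, c mod n)) * v $ s)"
    unfolding sum_distrib_left sum.distrib[symmetric]
    by (intro sum.cong) (simp_all add: entry distrib_right mult.assoc)
  also have "\<dots> = (\<Sum>s<n. (if c div n = j then A j $$ (s, c mod n) else 0) * v $ s)"
    by (simp add: H_part)
  also have "\<dots> = at_node N n j (transpose_mat (map_mat complex_of_real (A j)) *\<^sub>v v) $ c"
    using A[OF j] v c cm by (simp add: at_node_def scalar_prod_def atLeast0LessThan carrier_vecD)
  finally show "(transpose_mat (map_mat complex_of_real ?F) *\<^sub>v at_node N n j v) $ c =
      at_node N n j (transpose_mat (map_mat complex_of_real (A j)) *\<^sub>v v) $ c" .
qed (use network_state_mat_carrier[OF C H, of A] in \<open>simp add: at_node_def\<close>)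

lemma transpose_network_input_mat_at_node:
  fixes v :: "complex vec"
  assumes B: "B \<in> carrier_mat n m" and j: "j < N" and v: "v \<in> carrier_vec n"
    and vB: "transpose_mat (map_mat complex_of_real B) *\<^sub>v v = 0\<^sub>v m"
  shows "transpose_mat (map_mat complex_of_real (network_input_mat N d B)) *\<^sub>v at_node N n j v =
    0\<^sub>v (N * m)"
proof (rule eq_vecI)
  fix c assume "c < dim_vec (0\<^sub>v (N * m) :: complex vec)"
  then have c: "c < N * m"
    by simp
  then have "m > 0"
    by (cases m) auto
  let ?G = "network_input_mat N d B"
  have G: "?G \<in> carrier_mat (N * n) (N * m)"
    using B by (rule network_input_mat_carrier)
  have cm: "c mod m < m" and cd: "c div m < N"
    using \<open>m > 0\<close> c by (auto simp: less_mult_imp_div_less)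
  have entry: "?G $$ (j * n + s, c) = mat_diag N d $$ (j, c div m) * B $$ (s, c mod m)"
    if s: "s < n" for s
    using block_index_less[OF j s] c B s
    by (simp add: network_input_mat_def kronecker_def mat_diag_def)
  have B_part: "(\<Sum>s<n. complex_of_real (B $$ (s, c mod m)) * v $ s) = 0"
  proof -
    have "(transpose_mat (map_mat complex_of_real B) *\<^sub>v v) $ (c mod m) = 0"
      using vB cm by simp
    then show ?thesis
      using B v cm by (simp add: scalar_prod_def atLeast0LessThan carrier_vecD)
  qed
  have "(transpose_mat (map_mat complex_of_real ?G) *\<^sub>v at_node N n j v) $ c =
      (\<Sum>i<N * n. complex_of_real (?G $$ (i, c)) * at_node N n j v $ i)"
    using G c by (simp add: scalar_prod_def atLeast0LessThan at_node_def)
  also have "\<dots> = (\<Sum>s<n. complex_of_real (?G $$ (j * n + s, c)) * v $ s)"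
    by (rule sum_at_node[OF j])
  also have "\<dots> = mat_diag N d $$ (j, c div m) *
      (\<Sum>s<n. complex_of_real (B $$ (s, c mod m)) * v $ s)"
    by (simp add: entry sum_distrib_left mult_ac)
  finally show "(transpose_mat (map_mat complex_of_real ?G) *\<^sub>v at_node N n j v) $ c =
      0\<^sub>v (N * m) $ c"
    using c by (simp add: B_part)
qed (use network_input_mat_carrier[OF B, of N d] in simp)

section \<open>Controllability of a node is necessary\<close>

theorem theorem4p5:
  fixes N n m j :: nat
    and A :: "nat \<Rightarrow> real mat" and B C H :: "real mat" and d :: "nat \<Rightarrow> real"
  assumes A: "\<And>i. i < N \<Longrightarrow> A i \<in> carrier_mat n n"
    and B: "B \<in> carrier_mat n m"
    and C: "C \<in> carrier_mat N N"
    and H: "H \<in> carrier_mat n n"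
    and d: "\<And>i. i < N \<Longrightarrow> d i \<in> {0, 1}"
    and j: "j < N"
    and col_zero: "col C j = 0\<^sub>v N"
    and annihilate: "\<And>\<xi> \<mu>. left_eigenvector (map_mat complex_of_real (A j)) \<xi> \<mu> \<Longrightarrow>
      mat_of_row \<xi> * map_mat complex_of_real H = 0\<^sub>m 1 n"
    and network_controllable:
      "controllable (network_state_mat N A C H) (network_input_mat N d B)"
  shows "controllable (A j) B"
proof (rule ccontr)
  let ?F = "map_mat complex_of_real (network_state_mat N A C H)"
  let ?G = "map_mat complex_of_real (network_input_mat N d B)"
  let ?A = "map_mat complex_of_real (A j)"
  let ?B = "map_mat complex_of_real B"
  let ?H = "map_mat complex_of_real H"
  have F: "?F \<in> carrier_mat (N * n) (N * n)" and G: "?G \<in> carrier_mat (N * n) (N * m)"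
    using network_state_mat_carrier[OF C H] network_input_mat_carrier[OF B] by auto
  have cA: "?A \<in> carrier_mat n n" and cB: "?B \<in> carrier_mat n m" and cH: "?H \<in> carrier_mat n n"
    using A[OF j] B H by auto
  assume "\<not> controllable (A j) B"
  then have "\<not> controllable ?A ?B"
    using controllable_of_real_iff[OF A[OF j] B] by simp
  then obtain \<xi> \<mu> where ev: "left_eigenvector ?A \<xi> \<mu>" and \<xi>B: "mat_of_row \<xi> * ?B = 0\<^sub>m 1 m"
    using hautus_test[OF cA cB] by blast
  have \<xi>: "\<xi> \<in> carrier_vec n" "\<xi> \<noteq> 0\<^sub>v n" "transpose_mat ?A *\<^sub>v \<xi> = \<mu> \<cdot>\<^sub>v \<xi>"
    using ev cA by (auto simp: left_eigenvector_iff)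
  let ?v = "at_node N n j \<xi>"
  have v: "?v \<in> carrier_vec (N * n)"
    by (simp add: at_node_def)
  have \<xi>H: "transpose_mat ?H *\<^sub>v \<xi> = 0\<^sub>v n"
    using annihilate[OF ev] mat_of_row_mult_eq_0_iff[OF cH \<xi>(1)] by simp
  have "transpose_mat ?F *\<^sub>v ?v = at_node N n j (\<mu> \<cdot>\<^sub>v \<xi>)"
    using transpose_network_state_mat_at_node[OF A C H j \<xi>(1) \<xi>H] \<xi>(3) by simp
  also have "\<dots> = \<mu> \<cdot>\<^sub>v ?v"
    using \<xi>(1) by (intro eq_vecI)
      (auto simp: at_node_def intro!: index_smult_vec mod_less_divisor gr0I)
  finally have "left_eigenvector ?F ?v \<mu>"
    using F v at_node_eq_0_iff[OF j \<xi>(1)] \<xi>(2) by (simp add: left_eigenvector_iff)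
  moreover have "mat_of_row ?v * ?G = 0\<^sub>m 1 (N * m)"
    using transpose_network_input_mat_at_node[OF B j \<xi>(1)] \<xi>B
      mat_of_row_mult_eq_0_iff[OF cB \<xi>(1)] mat_of_row_mult_eq_0_iff[OF G v] by simp
  ultimately have "\<not> controllable ?F ?G"
    using hautus_test[OF F G] by blast
  then show False
    using network_controllable
      controllable_of_real_iff[OF network_state_mat_carrier[OF C H] network_input_mat_carrier[OF B]]
    by simp
qed

end
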